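(* Let $\widetilde u_{\mathrm{ms}}^\ell=\widetilde M_h^\ell(\widetilde u_H^\ell)$ and assume that there are $m_A,L_A>0$ with $$m_A\|v_h-w_h\|_V^2\le A(v_h;v_h-w_h)-A(w_h;v_h-w_h),\qquad \|A(v_h;\cdot)-A(w_h;\cdot)\|_{V_h'}\le L_A\|v_h-w_h\|_V\qquad\forall\,v_h,w_h\in\mathcal U_h,$$ and that $$\bigl\|\bigl(D\widetilde M_h^\ell(v_H)-D\widetilde M_h^\ell(w_H)\bigr)[\xi_H]\bigr\|_V\le L_{\widetilde M,1}^\ell\|v_H-w_H\|_V\|\xi_H\|_V\qquad\forall\,v_H,w_H\in\mathcal U_H,\ \forall\,\xi_H\in V_H .$$ Assume further that the coarse state solves the tangent-space coarse problem exactly, $$\operatorname{Res}(\widetilde u_{\mathrm{ms}}^\ell)\bigl(D\widetilde M_h^\ell(\widetilde u_H^\ell)[\xi_H]\bigr)=0\qquad\forall\,\xi_H\in V_H .$$ Let $e_h=u_h-\widetilde u_{\mathrm{ms}}^\ell$, $\gamma_{\mathrm{ch}}^\ell=\tfrac12L_AL_{\widetilde M,1}^\ell C_\Pi^2$ and $e_{\mathrm{loc}}^\ell=M_h(\Pi_Hu_h)-\widetilde M_h^\ell(\Pi_Hu_h)$. If $\gamma_{\mathrm{ch}}^\ell\|e_h\|_V\le\tfrac12m_A$, then $$\|u_h-\widetilde u_{\mathrm{ms}}^\ell\|_V\le\frac{2L_A}{m_A}\,\|e_{\mathrm{loc}}^\ell\|_V .$$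
   Context: Basic setting. Let $\Omega$ be a bounded polygonal or polyhedral domain with nested, shape-regular, quasi-uniform triangulations $\mathcal T_H$ (coarse) and $\mathcal T_h$ (fine, a refinement of $\mathcal T_H$); $V_H\subset V_h$ are the corresponding (finite-dimensional) spaces of continuous piecewise linear finite element functions with homogeneous Dirichlet boundary conditions, and $\|\cdot\|_V$ is the energy norm on $V_h$. $A(\cdot;\cdot):V_h\times V_h\to\mathbb R$ is nonlinear in its first and linear in its second argument; $L:V_h\to\mathbb R$ is linear. $u_h\in V_h$ is the (unique) solution of $A(u_h;v_h)=L(v_h)$ for all $v_h\in V_h$. $\Pi_H:V_h\to V_H$ is a linear projection onto $V_H$ ($\Pi_Hv_H=v_H$ for $v_H\in V_H$) with $\|\Pi_Hv_h\|_V\le C_\Pi\|v_h\|_V$ for all $v_h\in V_h$; $V_f=\ker\Pi_H$. Dual norms are $\|F\|_{V_h'}=\sup_{0\ne v_h\in V_h}|F(v_h)|/\|v_h\|_V$. The residual is $\operatorname{Res}(z_h)(w_h)=L(w_h)-A(z_h;w_h)$ for $z_h,w_h\in V_h$. Ideal reconstruction. For $v_H\in V_H$, $v_f(v_H)\in V_f$ is the (assumed unique) solution of $A(v_H+v_f(v_H);w_f)=L(w_f)$ for all $w_f\in V_f$, and $M_h(v_H)=v_H+v_f(v_H)$; one has $u_h=M_h(\Pi_Hu_h)$. Computable reconstructions. $\{\varphi_{H,i}\}_{i\in\mathcal I}$ is a partition of unity subordinate to $\mathcal T_H$, each support being a union of coarse elements; $\omega_i^0=\operatorname{int}(\operatorname{supp}\varphi_{H,i})$,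 and $\omega_i^\ell$ is obtained from $\omega_i^0$ by adding $\ell\ge0$ times all coarse elements whose closure meets the closure of the current set. With a basis $\{\Phi_j\}$ of $V_H$, $P_iv_H\in\mathbb R^{n_{H,i}}$ is the vector of those coefficients of $v_H$ whose basis functions have support meeting $\omega_i^\ell$. $V_{f,i}^\ell=\{v_f\in V_f:\operatorname{supp}v_f\subset\overline{\omega_i^\ell},\ v_f=0\text{ on }\partial\omega_i^\ell\}$; $R_i$ is restriction to $\omega_i^0$, $E_{i,0}^{\mathrm{ext}}$ is extension by zero from $\omega_i^0$, and $I_h$ is a stable linear fine-grid interpolation or projection into $V_h$. The local correction $v_{f,i}^\ell(P_iv_H)\in V_{f,i}^\ell$ is the (assumed unique) solution of $A_{\omega_i^\ell}(v_H+v_{f,i}^\ell(P_iv_H);w)=L_{\omega_i^\ell}(w)$ for all $w\in V_{f,i}^\ell$, where $A_{\omega_i^\ell},L_{\omega_i^\ell}$ are the restrictions of $A,L$ to the patch. The map $\widetilde M_h^\ell:V_H\to V_h$ is $$\widetilde M_h^\ell(v_H)=v_H+(I-\Pi_H)I_h\Bigl(\sum_{i\in\mathcal I}\varphi_{H,i}E_{i,0}^{\mathrm{ext}}\,\widetilde g_i^\ell(P_iv_H)\Bigr),$$ where either $\widetilde g_i^\ell=R_iv_{f,i}^\ell$ for all $i$ (patch-solved reconstruction) or $\widetilde g_i^\ell=\mathcal N_{f,i}^{\ell,\theta_i}$ for all $i$ (network-interpolated reconstruction), with $\mathcal N_{f,i}^{\ell,\theta_i}$ a given parametrized map from $\mathbb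 R^{n_{H,i}}$ to coefficient vectors identified with fine finite element functions on $\omega_i^0$. In particular $\Pi_H\widetilde M_h^\ell(v_H)=v_H$. Standing assumptions. $\mathcal U_h\subset V_h$ and $\mathcal U_H\subset V_H$ are admissible sets; $\widetilde M_h^\ell$ is differentiable on $\mathcal U_H$; $\widetilde u_H^\ell\in V_H$ is the computed coarse state; the segment $\widetilde u_H^\ell+s(\Pi_Hu_h-\widetilde u_H^\ell)$, $0\le s\le1$, lies in $\mathcal U_H$; and $u_h$, $\widetilde u_{\mathrm{ms}}^\ell$, $\widetilde M_h^\ell(\Pi_Hu_h)$ lie in $\mathcal U_h$. *)

theory Defs
  imports "HOL-Analysis.Analysis"
begin

section \<open>Domains, meshes and finite element spaces\<close>

definition polyhedral_domain :: "'a::euclidean_space set \<Rightarrow> bool" where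
  "polyhedral_domain \<Omega> \<longleftrightarrow>
     (DIM('a) = 2 \<or> DIM('a) = 3) \<and>
     open \<Omega> \<and> connected \<Omega> \<and> bounded \<Omega> \<and> \<Omega> \<noteq> {} \<and> interior (closure \<Omega>) = \<Omega> \<and>
     (\<exists>\<P>. finite \<P> \<and> (\<forall>P\<in>\<P>. polytope P) \<and> closure \<Omega> = \<Union>\<P>)"

text \<open>The elements of a mesh are closed simplices of full dimension.\<close>

definition mesh_of :: "'a::euclidean_space set \<Rightarrow> 'a set set \<Rightarrow> bool" where
  "mesh_of \<Omega> \<T> \<longleftrightarrow>
     triangulation \<T> \<and> (\<forall>T\<in>\<T>. int DIM('a) simplex T) \<and> \<Union>\<T> = closure \<Omega>"

definition refines :: "'a set set \<Rightarrow> 'a set set \<Rightarrow> bool" where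
  "refines \<T>' \<T> \<longleftrightarrow> (\<forall>t\<in>\<T>'. \<exists>T\<in>\<T>. t \<subseteq> T)"

definition shape_regular :: "real \<Rightarrow> 'a::euclidean_space set set \<Rightarrow> bool" where
  "shape_regular \<sigma> \<T> \<longleftrightarrow> (\<forall>T\<in>\<T>. \<exists>x r. cball x r \<subseteq> T \<and> r > 0 \<and> diameter T \<le> \<sigma> * r)"

definition quasi_uniform :: "real \<Rightarrow> 'a::euclidean_space set set \<Rightarrow> bool" where
  "quasi_uniform \<kappa> \<T> \<longleftrightarrow> (\<forall>T\<in>\<T>. \<forall>T'\<in>\<T>. diameter T \<le> \<kappa> * diameter T')"

definition mesh_vertices :: "'a::euclidean_space set set \<Rightarrow> 'a set" where
  "mesh_vertices \<T> = {z. \<exists>T\<in>\<T>. z extreme_point_of T}"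

text \<open>A continuous piecewise linear function with homogeneous Dirichlet values is identified with
  its continuous extension by zero to the whole space. The finite element spaces thus become
  finite-dimensional subspaces of the space of bounded continuous functions. The supremum norm of
  that type serves only as a carrier of the (unique) vector space topology of these subspaces; the
  norm of the theory is the energy norm introduced below.\<close>

type_synonym 'a fe = "'a \<Rightarrow>\<^sub>C real"

definition P1_zero :: "'a::euclidean_space set \<Rightarrow> 'a set set \<Rightarrow> 'a fe set" where
  "P1_zero \<Omega> \<T> =
     {v. (\<forall>x. x \<notin> \<Omega> \<longrightarrow> apply_bcontfun v x = 0) \<and>
         (\<forall>T\<in>\<T>. \<exists>a b. \<forall>x\<in>T. apply_bcontfun v x = a + b \<bullet> x)}"

definition fsupp :: "('a::topological_space \<Rightarrow> real) \<Rightarrow> 'a set" where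
  "fsupp f = closure {x. f x \<noteq> 0}"

definition ext_zero :: "'a set \<Rightarrow> ('a \<Rightarrow> real) \<Rightarrow> 'a \<Rightarrow> real" where
  "ext_zero \<omega> g = (\<lambda>x. if x \<in> \<omega> then g x else 0)"

definition lin_on :: "'v::real_vector set \<Rightarrow> ('v \<Rightarrow> 'w::real_vector) \<Rightarrow> bool" where
  "lin_on V f \<longleftrightarrow>
     (\<forall>u\<in>V. \<forall>v\<in>V. f (u + v) = f u + f v) \<and> (\<forall>c. \<forall>u\<in>V. f (c *\<^sub>R u) = c *\<^sub>R f u)"

definition inner_product_on :: "'v::real_vector set \<Rightarrow> ('v \<Rightarrow> 'v \<Rightarrow> real) \<Rightarrow> bool" where
  "inner_product_on V a \<longleftrightarrow>
     (\<forall>u\<in>V. lin_on V (a u)) \<and> (\<forall>u\<in>V. \<forall>v\<in>V. a u v = a v u) \<and> (\<forall>u\<in>V. u \<noteq> 0 \<longrightarrow> a u u > 0)"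


section \<open>The data of the multiscale method\<close>

datatype recon_mode = Patch_Solved | Network_Interpolated

text \<open>
  \<^item> \<open>energy\<close> is the inner product inducing the energy norm.
  \<^item> \<open>patch_form i\<close> and \<open>patch_load i\<close> are the restrictions of \<open>form\<close> and \<open>load\<close> to the patch
    with \<open>layers\<close> layers belonging to \<open>pou i\<close>.
  \<^item> \<open>cbasis 0, \<dots>, cbasis (cdim - 1)\<close> is the basis of the coarse space.
  \<^item> \<open>net i \<theta>\<close> maps coarse coefficient vectors to fine ones. The fine coefficient vectors
    of length \<open>fdim i\<close> refer to the functions \<open>fbasis i 0, \<dots>, fbasis i (fdim i - 1)\<close>.
\<close>

record (overloaded) ('a, 'i) multiscale =
  domain :: "'a::euclidean_space set"
  cmesh :: "'a set set"
  fmesh :: "'a set set"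
  reg_const :: real
  qu_const :: real
  energy :: "'a fe \<Rightarrow> 'a fe \<Rightarrow> real"
  form :: "'a fe \<Rightarrow> 'a fe \<Rightarrow> real"
  load :: "'a fe \<Rightarrow> real"
  proj :: "'a fe \<Rightarrow> 'a fe"
  proj_const :: real
  indices :: "'i set"
  pou :: "'i \<Rightarrow> 'a \<Rightarrow> real"
  layers :: nat
  cdim :: nat
  cbasis :: "nat \<Rightarrow> 'a fe"
  patch_form :: "'i \<Rightarrow> 'a fe \<Rightarrow> 'a fe \<Rightarrow> real"
  patch_load :: "'i \<Rightarrow> 'a fe \<Rightarrow> real"
  interp :: "('a \<Rightarrow> real) \<Rightarrow> 'a fe"
  mode :: recon_mode
  net :: "'i \<Rightarrow> real list \<Rightarrow> real list \<Rightarrow> real list"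
  net_param :: "'i \<Rightarrow> real list"
  fdim :: "'i \<Rightarrow> nat"
  fbasis :: "'i \<Rightarrow> nat \<Rightarrow> 'a \<Rightarrow> real"

definition V_h :: "('a::euclidean_space, 'i) multiscale \<Rightarrow> 'a fe set" where
  "V_h S = P1_zero (domain S) (fmesh S)"

definition V_H :: "('a::euclidean_space, 'i) multiscale \<Rightarrow> 'a fe set" where
  "V_H S = P1_zero (domain S) (cmesh S)"

definition V_f :: "('a::euclidean_space, 'i) multiscale \<Rightarrow> 'a fe set" where
  "V_f S = {v \<in> V_h S. proj S v = 0}"

definition normV :: "('a::euclidean_space, 'i) multiscale \<Rightarrow> 'a fe \<Rightarrow> real" where
  "normV S v = sqrt (energy S v v)"

text \<open>The element 0 is inserted to fix the value of the supremum when the space is trivial.\<close>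

definition dual_norm :: "('a::euclidean_space, 'i) multiscale \<Rightarrow> ('a fe \<Rightarrow> real) \<Rightarrow> real" where
  "dual_norm S F = Sup (insert 0 {\<bar>F v\<bar> / normV S v | v. v \<in> V_h S \<and> v \<noteq> 0})"

definition Res :: "('a::euclidean_space, 'i) multiscale \<Rightarrow> 'a fe \<Rightarrow> 'a fe \<Rightarrow> real" where
  "Res S z w = load S w - form S z w"


subsection \<open>Ideal reconstruction\<close>

definition fine_correction_eq ::
    "('a::euclidean_space, 'i) multiscale \<Rightarrow> 'a fe \<Rightarrow> 'a fe \<Rightarrow> bool" where
  "fine_correction_eq S vH v \<longleftrightarrow> v \<in> V_f S \<and> (\<forall>w\<in>V_f S. form S (vH + v) w = load S w)"

definition fine_correction :: "('a::euclidean_space, 'i) multiscale \<Rightarrow> 'a fe \<Rightarrow> 'a fe" where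
  "fine_correction S vH = (THE v. fine_correction_eq S vH v)"

definition M_h :: "('a::euclidean_space, 'i) multiscale \<Rightarrow> 'a fe \<Rightarrow> 'a fe" where
  "M_h S vH = vH + fine_correction S vH"


subsection \<open>Patches and local corrections\<close>

definition pou_supp :: "('a::euclidean_space, 'i) multiscale \<Rightarrow> 'i \<Rightarrow> 'a set" where
  "pou_supp S i = closure {x \<in> closure (domain S). pou S i x \<noteq> 0}"

primrec patch :: "('a::euclidean_space, 'i) multiscale \<Rightarrow> 'i \<Rightarrow> nat \<Rightarrow> 'a set" where
  "patch S i 0 = interior (pou_supp S i)"
| "patch S i (Suc k) =
     interior (closure (patch S i k) \<union> \<Union>{T \<in> cmesh S. T \<inter> closure (patch S i k) \<noteq> {}})"

abbreviation \<omega>0 :: "('a::euclidean_space, 'i) multiscale \<Rightarrow> 'i \<Rightarrow> 'a set" where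
  "\<omega>0 S i \<equiv> patch S i 0"

abbreviation \<omega>l :: "('a::euclidean_space, 'i) multiscale \<Rightarrow> 'i \<Rightarrow> 'a set" where
  "\<omega>l S i \<equiv> patch S i (layers S)"

definition V_patch :: "('a::euclidean_space, 'i) multiscale \<Rightarrow> 'i \<Rightarrow> 'a fe set" where
  "V_patch S i = {v \<in> V_h S. fsupp (apply_bcontfun v) \<subseteq> closure (\<omega>l S i) \<and>
                             (\<forall>x\<in>frontier (\<omega>l S i). apply_bcontfun v x = 0)}"

definition V_fi :: "('a::euclidean_space, 'i) multiscale \<Rightarrow> 'i \<Rightarrow> 'a fe set" where
  "V_fi S i = V_f S \<inter> V_patch S i"

definition coarse_coeff :: "('a::euclidean_space, 'i) multiscale \<Rightarrow> 'a fe \<Rightarrow> nat \<Rightarrow> real" where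
  "coarse_coeff S v j = representation (cbasis S ` {..<cdim S}) v (cbasis S j)"

definition P_inds :: "('a::euclidean_space, 'i) multiscale \<Rightarrow> 'i \<Rightarrow> nat list" where
  "P_inds S i = filter (\<lambda>j. fsupp (apply_bcontfun (cbasis S j)) \<inter> \<omega>l S i \<noteq> {}) [0..<cdim S]"

definition P_loc :: "('a::euclidean_space, 'i) multiscale \<Rightarrow> 'i \<Rightarrow> 'a fe \<Rightarrow> real list" where
  "P_loc S i v = map (coarse_coeff S v) (P_inds S i)"

text \<open>For a form given by an integral, the restriction to a patch is obtained by integrating over
  the patch only. For an abstract form this is captured by two properties: the
  restriction sees its arguments only on the patch, and it agrees with the global form on test
  functions supported in the patch.\<close>

definition restricts_to_patch :: "('a::euclidean_space, 'i) multiscale \<Rightarrow> 'i \<Rightarrow> bool" where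
  "restricts_to_patch S i \<longleftrightarrow>
     (\<forall>z\<in>V_h S. \<forall>w\<in>V_patch S i. patch_form S i z w = form S z w) \<and>
     (\<forall>w\<in>V_patch S i. patch_load S i w = load S w) \<and>
     (\<forall>z\<in>V_h S. \<forall>z'\<in>V_h S. \<forall>w\<in>V_h S. \<forall>w'\<in>V_h S.
        (\<forall>x\<in>\<omega>l S i. apply_bcontfun z x = apply_bcontfun z' x) \<and>
        (\<forall>x\<in>\<omega>l S i. apply_bcontfun w x = apply_bcontfun w' x) \<longrightarrow>
        patch_form S i z w = patch_form S i z' w' \<and> patch_load S i w = patch_load S i w')"

definition local_correction_eq ::
    "('a::euclidean_space, 'i) multiscale \<Rightarrow> 'i \<Rightarrow> 'a fe \<Rightarrow> 'a fe \<Rightarrow> bool" where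
  "local_correction_eq S i vH v \<longleftrightarrow>
     v \<in> V_fi S i \<and> (\<forall>w\<in>V_fi S i. patch_form S i (vH + v) w = patch_load S i w)"

text \<open>The local correction is a function of the local coefficient vector \<open>p\<close> alone: coarse functions
  with the same local coefficients coincide on the patch, so they have the same solutions.\<close>

definition local_correction ::
    "('a::euclidean_space, 'i) multiscale \<Rightarrow> 'i \<Rightarrow> real list \<Rightarrow> 'a fe" where
  "local_correction S i p =
     (THE v. \<forall>vH\<in>V_H S. P_loc S i vH = p \<longrightarrow> local_correction_eq S i vH v)"


subsection \<open>Computable reconstruction\<close>

text \<open>Functions on \<open>\<omega>0 S i\<close> are represented as extensional functions (\<^const>\<open>restrict\<close>).\<close>

definition fine_functions :: "('a::euclidean_space, 'i) multiscale \<Rightarrow> 'i \<Rightarrow> ('a \<Rightarrow> real) set" where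
  "fine_functions S i = {restrict (apply_bcontfun v) (\<omega>0 S i) | v. v \<in> V_h S}"

definition fine_of_coeffs ::
    "('a::euclidean_space, 'i) multiscale \<Rightarrow> 'i \<Rightarrow> real list \<Rightarrow> 'a \<Rightarrow> real" where
  "fine_of_coeffs S i c = restrict (\<lambda>x. \<Sum>k<fdim S i. c ! k * fbasis S i k x) (\<omega>0 S i)"

definition local_function ::
    "('a::euclidean_space, 'i) multiscale \<Rightarrow> 'i \<Rightarrow> real list \<Rightarrow> 'a \<Rightarrow> real" where
  "local_function S i p =
     (case mode S of
        Patch_Solved \<Rightarrow> restrict (apply_bcontfun (local_correction S i p)) (\<omega>0 S i)
      | Network_Interpolated \<Rightarrow> fine_of_coeffs S i (net S i (net_param S i) p))"

definition M_tilde :: "('a::euclidean_space, 'i) multiscale \<Rightarrow> 'a fe \<Rightarrow> 'a fe" where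
  "M_tilde S vH =
     (let c = interp S (\<lambda>x. \<Sum>i\<in>indices S. pou S i x * ext_zero (\<omega>0 S i) (local_function S i (P_loc S i vH)) x)
      in vH + (c - proj S c))"

text \<open>The derivative as a map on \<open>V_H S\<close>. It is determined only in directions from \<open>V_H S\<close>. Both
  spaces being finite-dimensional, differentiability with respect to the supremum norm and with
  respect to the energy norm coincide, with the same derivative.\<close>

definition M_differentiable_at :: "('a::euclidean_space, 'i) multiscale \<Rightarrow> 'a fe \<Rightarrow> bool" where
  "M_differentiable_at S vH \<longleftrightarrow> M_tilde S differentiable (at vH within V_H S)"

definition DM_tilde :: "('a::euclidean_space, 'i) multiscale \<Rightarrow> 'a fe \<Rightarrow> 'a fe \<Rightarrow> 'a fe" where
  "DM_tilde S vH = frechet_derivative (M_tilde S) (at vH within V_H S)"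


section \<open>Standing assumptions on the data\<close>

definition discretization :: "('a::euclidean_space, 'i) multiscale \<Rightarrow> bool" where
  "discretization S \<longleftrightarrow>
     polyhedral_domain (domain S) \<and> mesh_of (domain S) (cmesh S) \<and> mesh_of (domain S) (fmesh S) \<and>
     refines (fmesh S) (cmesh S) \<and>
     shape_regular (reg_const S) (cmesh S) \<and> shape_regular (reg_const S) (fmesh S) \<and>
     quasi_uniform (qu_const S) (cmesh S) \<and> quasi_uniform (qu_const S) (fmesh S) \<and>
     inner_product_on (V_h S) (energy S)"

definition variational_problem :: "('a::euclidean_space, 'i) multiscale \<Rightarrow> bool" where
  "variational_problem S \<longleftrightarrow> (\<forall>z\<in>V_h S. lin_on (V_h S) (form S z)) \<and> lin_on (V_h S) (load S)"

definition coarse_projection :: "('a::euclidean_space, 'i) multiscale \<Rightarrow> bool" where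
  "coarse_projection S \<longleftrightarrow>
     lin_on (V_h S) (proj S) \<and> proj S ` V_h S \<subseteq> V_H S \<and> (\<forall>v\<in>V_H S. proj S v = v) \<and>
     (\<forall>v\<in>V_h S. normV S (proj S v) \<le> proj_const S * normV S v)"

definition ideal_corrections :: "('a::euclidean_space, 'i) multiscale \<Rightarrow> bool" where
  "ideal_corrections S \<longleftrightarrow> (\<forall>vH\<in>V_H S. \<exists>!v. fine_correction_eq S vH v)"

definition partition_of_unity :: "('a::euclidean_space, 'i) multiscale \<Rightarrow> bool" where
  "partition_of_unity S \<longleftrightarrow>
     finite (indices S) \<and>
     (\<forall>i\<in>indices S. continuous_on (closure (domain S)) (pou S i) \<and>
        (\<forall>x\<in>closure (domain S). 0 \<le> pou S i x) \<and> (\<exists>\<S>\<subseteq>cmesh S. pou_supp S i = \<Union>\<S>)) \<and>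
     (\<forall>x\<in>closure (domain S). (\<Sum>i\<in>indices S. pou S i x) = 1)"

definition coarse_basis :: "('a::euclidean_space, 'i) multiscale \<Rightarrow> bool" where
  "coarse_basis S \<longleftrightarrow>
     inj_on (cbasis S) {..<cdim S} \<and> independent (cbasis S ` {..<cdim S}) \<and>
     span (cbasis S ` {..<cdim S}) = V_H S"

definition local_corrections :: "('a::euclidean_space, 'i) multiscale \<Rightarrow> bool" where
  "local_corrections S \<longleftrightarrow>
     (\<forall>i\<in>indices S. restricts_to_patch S i \<and> (\<forall>vH\<in>V_H S. \<exists>!v. local_correction_eq S i vH v))"

text \<open>The functions to which the fine-grid operator is applied are localized fine functions. They
  form, together with \<open>V_h S\<close>, a finite-dimensional space of bounded functions. The norm in
  which stability is expressed is therefore immaterial.\<close>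

definition interp_domain :: "('a::euclidean_space, 'i) multiscale \<Rightarrow> ('a \<Rightarrow> real) set" where
  "interp_domain S =
     {\<lambda>x. (\<Sum>i\<in>indices S. pou S i x * ext_zero (\<omega>0 S i) (g i) x) + apply_bcontfun w x | g w.
        (\<forall>i\<in>indices S. g i \<in> fine_functions S i) \<and> w \<in> V_h S}"

definition fine_interpolation :: "('a::euclidean_space, 'i) multiscale \<Rightarrow> bool" where
  "fine_interpolation S \<longleftrightarrow>
     (\<forall>f\<in>interp_domain S. interp S f \<in> V_h S) \<and>
     (\<forall>f\<in>interp_domain S. \<forall>g\<in>interp_domain S.
        interp S (\<lambda>x. f x + g x) = interp S f + interp S g) \<and>
     (\<forall>c. \<forall>f\<in>interp_domain S. interp S (\<lambda>x. c * f x) = c *\<^sub>R interp S f) \<and>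
     (\<exists>C. \<forall>f\<in>interp_domain S. normV S (interp S f) \<le> C * (SUP x. \<bar>f x\<bar>)) \<and>
     ((\<forall>f\<in>interp_domain S. \<forall>z\<in>mesh_vertices (fmesh S). apply_bcontfun (interp S f) z = f z) \<or>
      (\<forall>v\<in>V_h S. interp S (apply_bcontfun v) = v))"

text \<open>The identification of coefficient vectors with fine functions on \<open>\<omega>0 S i\<close>.\<close>

definition network_maps :: "('a::euclidean_space, 'i) multiscale \<Rightarrow> bool" where
  "network_maps S \<longleftrightarrow>
     (\<forall>i\<in>indices S.
        bij_betw (fine_of_coeffs S i) {c. length c = fdim S i} (fine_functions S i) \<and>
        (\<forall>\<theta> p. length p = length (P_inds S i) \<longrightarrow> length (net S i \<theta> p) = fdim S i))"

definition multiscale_setting :: "('a::euclidean_space, 'i) multiscale \<Rightarrow> bool" where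
  "multiscale_setting S \<longleftrightarrow>
     discretization S \<and> variational_problem S \<and> coarse_projection S \<and> ideal_corrections S \<and>
     partition_of_unity S \<and> coarse_basis S \<and> local_corrections S \<and> fine_interpolation S \<and>
     network_maps S"

definition fine_solution :: "('a::euclidean_space, 'i) multiscale \<Rightarrow> 'a fe \<Rightarrow> bool" where
  "fine_solution S u \<longleftrightarrow> u \<in> V_h S \<and> (\<forall>v\<in>V_h S. form S u v = load S v)"

end

theory Submission
  imports Defs
begin

text \<open>Let \<open>F = Res(u_ms)\<close>, which on \<open>V_h\<close> is \<open>A(u_h; \<cdot>) - A(u_ms; \<cdot>)\<close>. Monotonicity bounds
  \<open>F(e_h)\<close> from below by the squared error. As the reconstruction is a right inverse of the
  projection, \<open>\<delta> = \<Pi> u_h - u_H\<close> equals \<open>\<Pi> e_h\<close>, and \<open>e_h\<close> splits into \<open>e_loc\<close>, the tangent vector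
  \<open>DM(u_H)[\<delta>]\<close>, which \<open>F\<close> annihilates, and a Taylor remainder that is quadratic in \<open>\<delta>\<close>. The smallness
  condition absorbs the remainder. Only \<open>F\<close> of the remainder is needed, so a scalar mean value
  theorem suffices. Point values at finitely many nodes determine the functions in \<open>V_h\<close>; hence
  \<open>V_h\<close> is closed, so that it contains the derivatives, and linear functionals on it are bounded,
  so that the supremum in the dual norm is finite.\<close>

section \<open>Finite-dimensional spaces of functions\<close>

lemma lin_on_add: "lin_on V f \<Longrightarrow> u \<in> V \<Longrightarrow> v \<in> V \<Longrightarrow> f (u + v) = f u + f v"
  by (simp add: lin_on_def)

lemma lin_on_scale: "lin_on V f \<Longrightarrow> u \<in> V \<Longrightarrow> f (c *\<^sub>R u) = c *\<^sub>R f u"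
  by (simp add: lin_on_def)

lemma lin_on_diff:
  assumes "subspace V" "lin_on V f" "u \<in> V" "v \<in> V"
  shows "f (u - v) = f u - f v"
  using lin_on_add[OF assms(2), of "u - v" v] assms by (simp add: subspace_diff)

lemma lin_on_zero: "subspace V \<Longrightarrow> lin_on V f \<Longrightarrow> f 0 = 0"
  using lin_on_scale[of V f 0 0] by (simp add: subspace_0)

lemma lin_on_sum:
  assumes "subspace V" "lin_on V f" "finite K" "\<And>k. k \<in> K \<Longrightarrow> b k \<in> V"
  shows "f (\<Sum>k\<in>K. c k *\<^sub>R b k) = (\<Sum>k\<in>K. c k *\<^sub>R f (b k))"
  using assms(3,4)
proof (induction K rule: finite_induct)
  case empty
  show ?case using lin_on_zero[OF assms(1,2)] by simp
next
  case (insert k K)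
  then have "(\<Sum>k\<in>K. c k *\<^sub>R b k) \<in> V" "c k *\<^sub>R b k \<in> V"
    using assms(1) by (auto intro!: subspace_sum subspace_scale)
  with insert show ?case
    by (simp add: lin_on_add[OF assms(2)] lin_on_scale[OF assms(2)])
qed

lemma lin_on_bounded_linear: "bounded_linear f \<Longrightarrow> lin_on V f"
  by (simp add: lin_on_def bounded_linear.linear linear_add linear_cmul)

text \<open>The dual basis property of a separating family, allowing for redundant functionals.\<close>

lemma separating_functionals_reconstruct:
  fixes V :: "'v::real_vector set" and \<phi> :: "'k \<Rightarrow> 'v \<Rightarrow> real"
  assumes "finite K" "subspace V" "\<And>k. k \<in> K \<Longrightarrow> lin_on V (\<phi> k)"
    and "\<And>v. v \<in> V \<Longrightarrow> \<forall>k\<in>K. \<phi> k v = 0 \<Longrightarrow> v = 0"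
  shows "\<exists>b. (\<forall>k\<in>K. b k \<in> V) \<and> (\<forall>v\<in>V. v = (\<Sum>k\<in>K. \<phi> k v *\<^sub>R b k))"
  using assms
proof (induction K arbitrary: V rule: finite_induct)
  case empty
  then show ?case by auto
next
  case (insert k K)
  have lk: "lin_on V (\<phi> k)" using insert.prems(2) by simp
  \<comment> \<open>The induction hypothesis is applied to the kernel of \<open>\<phi> k\<close>
    instead of \<open>V\<close>: on it the remaining functionals alone separate points.\<close>
  define W where "W = {v \<in> V. \<phi> k v = 0}"
  have subW: "subspace W"
    using insert.prems(1) lk lin_on_zero[OF insert.prems(1) lk]
    by (auto simp: W_def subspace_def lin_on_def)
  have "\<exists>b. (\<forall>k\<in>K. b k \<in> W) \<and> (\<forall>v\<in>W. v = (\<Sum>k\<in>K. \<phi> k v *\<^sub>R b k))"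
    using insert.prems(2,3) by (intro insert.IH subW) (auto simp: W_def lin_on_def)
  then obtain b where b: "\<And>k. k \<in> K \<Longrightarrow> b k \<in> W" "\<And>v. v \<in> W \<Longrightarrow> v = (\<Sum>k\<in>K. \<phi> k v *\<^sub>R b k)"
    by blast
  have split: "(\<Sum>j\<in>insert k K. \<phi> j v *\<^sub>R (b(k := c)) j) = \<phi> k v *\<^sub>R c + (\<Sum>j\<in>K. \<phi> j v *\<^sub>R b j)" for v c
    using insert.hyps by (auto intro!: sum.cong)
  show ?case
  proof (cases "W = V")
    case True
    \<comment> \<open>Here \<open>\<phi> k\<close> vanishes on all of \<open>V\<close>; being
      redundant, it gets the vector 0.\<close>
    then show ?thesis
      using b insert.prems(1) split[of _ 0]
      by (intro exI[of _ "b(k := 0)"]) (auto simp: subspace_0)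
  next
    case False
    then obtain v1 where v1: "v1 \<in> V" "\<phi> k v1 \<noteq> 0" by (auto simp: W_def)
    define v0 where "v0 = (1 / \<phi> k v1) *\<^sub>R v1"
    have v0: "v0 \<in> V" "\<phi> k v0 = 1"
      using v1 insert.prems(1) lin_on_scale[OF lk, of v1] by (auto simp: v0_def subspace_scale)
    \<comment> \<open>From \<open>v0\<close> the part already reproduced by the \<open>b j\<close>
      is removed, so that it is not counted twice.\<close>
    define c where "c = v0 - (\<Sum>j\<in>K. \<phi> j v0 *\<^sub>R b j)"
    have "(\<Sum>j\<in>K. \<phi> j v0 *\<^sub>R b j) \<in> V"
      using b(1) insert.prems(1) by (intro subspace_sum subspace_scale) (auto simp: W_def)
    then have cV: "c \<in> V" using v0 insert.prems(1) by (simp add: c_def subspace_diff)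
    have "v = \<phi> k v *\<^sub>R c + (\<Sum>j\<in>K. \<phi> j v *\<^sub>R b j)" if v: "v \<in> V" for v
    proof -
      have sV: "\<phi> k v *\<^sub>R v0 \<in> V" using v0 insert.prems(1) by (simp add: subspace_scale)
      define w where "w = v - \<phi> k v *\<^sub>R v0"
      have \<phi>w: "\<phi> j w = \<phi> j v - \<phi> k v * \<phi> j v0" if "j \<in> insert k K" for j
        using lin_on_diff[OF insert.prems(1) insert.prems(2)[OF that] v sV]
          lin_on_scale[OF insert.prems(2)[OF that] v0(1)] by (simp add: w_def)
      have "w \<in> W" using v sV insert.prems(1) \<phi>w[of k] v0 by (simp add: W_def w_def subspace_diff)
      from b(2)[OF this] have "w = (\<Sum>j\<in>K. (\<phi> j v - \<phi> k v * \<phi> j v0) *\<^sub>R b j)"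
        using \<phi>w by simp
      also have "\<dots> = (\<Sum>j\<in>K. \<phi> j v *\<^sub>R b j) - \<phi> k v *\<^sub>R (\<Sum>j\<in>K. \<phi> j v0 *\<^sub>R b j)"
        by (simp add: scaleR_diff_left sum_subtractf scaleR_sum_right)
      finally show ?thesis by (simp add: w_def c_def algebra_simps)
    qed
    then show ?thesis
      using b(1) cV split[of _ c] by (intro exI[of _ "b(k := c)"]) (auto simp: W_def)
  qed
qed

section \<open>Nodal description of continuous piecewise linear functions\<close>

lemma apply_bcontfun_sum: "apply_bcontfun (\<Sum>k\<in>K. f k) x = (\<Sum>k\<in>K. apply_bcontfun (f k) x)"
  by (induction K rule: infinite_finite_induct) auto

lemma bounded_linear_apply_bcontfun: "bounded_linear (\<lambda>v. apply_bcontfun v x)"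
  by (rule bounded_linear_intro[where K = 1]) (auto simp: norm_bounded)

lemma P1_zero_affine:
  assumes "v \<in> P1_zero \<Omega> \<T>" "T \<in> \<T>"
  obtains a b where "\<And>x. x \<in> T \<Longrightarrow> apply_bcontfun v x = a + b \<bullet> x"
  using assms unfolding P1_zero_def by blast

lemma subspace_P1_zero: "subspace (P1_zero \<Omega> \<T>)"
proof (rule subspaceI)
  show "0 \<in> P1_zero \<Omega> \<T>"
    by (auto simp: P1_zero_def intro!: exI[of _ 0])
next
  fix u v assume uv: "u \<in> P1_zero \<Omega> \<T>" "v \<in> P1_zero \<Omega> \<T>"
  have "\<exists>a b. \<forall>x\<in>T. apply_bcontfun (u + v) x = a + b \<bullet> x" if T: "T \<in> \<T>" for T
  proof -
    obtain a b a' b' where "\<And>x. x \<in> T \<Longrightarrow> apply_bcontfun u x = a + b \<bullet> x"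
      "\<And>x. x \<in> T \<Longrightarrow> apply_bcontfun v x = a' + b' \<bullet> x"
      using P1_zero_affine[OF uv(1) T] P1_zero_affine[OF uv(2) T] by metis
    then show ?thesis
      by (intro exI[of _ "a + a'"] exI[of _ "b + b'"]) (simp add: inner_add_left)
  qed
  with uv show "u + v \<in> P1_zero \<Omega> \<T>" by (auto simp: P1_zero_def)
next
  fix c u assume u: "u \<in> P1_zero \<Omega> \<T>"
  have "\<exists>a b. \<forall>x\<in>T. apply_bcontfun (c *\<^sub>R u) x = a + b \<bullet> x" if T: "T \<in> \<T>" for T
  proof -
    obtain a b where "\<And>x. x \<in> T \<Longrightarrow> apply_bcontfun u x = a + b \<bullet> x"
      using P1_zero_affine[OF u T] by blast
    then show ?thesis
      by (intro exI[of _ "c * a"] exI[of _ "c *\<^sub>R b"]) (simp add: algebra_simps)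
  qed
  with u show "c *\<^sub>R u \<in> P1_zero \<Omega> \<T>" by (auto simp: P1_zero_def)
qed

lemma P1_zero_refines: "refines \<T>' \<T> \<Longrightarrow> P1_zero \<Omega> \<T> \<subseteq> P1_zero \<Omega> \<T>'"
  unfolding P1_zero_def refines_def by (auto, meson subsetD)

text \<open>The nodes are the vertices of all mesh simplices: the zero set of an affine function is
  convex, so with the vertices of a simplex it contains the whole simplex.\<close>

lemma finite_nodes:
  assumes "mesh_of \<Omega> \<T>"
  obtains Z where "finite Z"
    "\<And>v. v \<in> P1_zero \<Omega> \<T> \<Longrightarrow> \<forall>z\<in>Z. apply_bcontfun v z = 0 \<Longrightarrow> v = 0"
proof -
  have "\<forall>T\<in>\<T>. \<exists>C. finite C \<and> T = convex hull C"
    using assms by (fastforce simp: mesh_of_def simplex)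
  then obtain C where C: "\<And>T. T \<in> \<T> \<Longrightarrow> finite (C T) \<and> T = convex hull (C T)" by metis
  have fin: "finite (\<Union>(C ` \<T>))"
    using assms C by (auto simp: mesh_of_def triangulation_def)
  have "v = 0" if v: "v \<in> P1_zero \<Omega> \<T>" "\<forall>z\<in>\<Union>(C ` \<T>). apply_bcontfun v z = 0" for v
  proof (rule bcontfun_eqI)
    fix x
    show "apply_bcontfun v x = apply_bcontfun 0 x"
    proof (cases "x \<in> \<Omega>")
      case False
      then show ?thesis using v by (auto simp: P1_zero_def)
    next
      case True
      then have "x \<in> \<Union>\<T>" using assms closure_subset by (auto simp: mesh_of_def)
      then obtain T where T: "T \<in> \<T>" "x \<in> T" by blast
      then obtain a b where ab: "\<And>y. y \<in> T \<Longrightarrow> apply_bcontfun v y = a + b \<bullet> y"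
        using P1_zero_affine[OF v(1) T(1)] by blast
      have "C T \<subseteq> {y. b \<bullet> y = - a}"
      proof
        fix z assume z: "z \<in> C T"
        then have "z \<in> T" using C[OF T(1)] hull_subset by fastforce
        with ab z v T show "z \<in> {y. b \<bullet> y = - a}" by fastforce
      qed
      then have "convex hull (C T) \<subseteq> {y. b \<bullet> y = - a}"
        by (rule hull_minimal) (rule convex_hyperplane)
      with ab[OF T(2)] T C[OF T(1)] show ?thesis by auto
    qed
  qed
  with fin that show thesis by blast
qed

text \<open>The \<open>b z\<close> need not be hat functions: \<open>Z\<close> may contain boundary
  vertices, where every function of the space vanishes, so the evaluations may be redundant.\<close>

lemma P1_zero_reconstruct:
  assumes "mesh_of \<Omega> \<T>"
  obtains Z b where "finite Z" "\<And>z. b z \<in> P1_zero \<Omega> \<T>"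
    "\<And>v. v \<in> P1_zero \<Omega> \<T> \<Longrightarrow> v = (\<Sum>z\<in>Z. apply_bcontfun v z *\<^sub>R b z)"
proof -
  obtain Z where Z: "finite Z"
    "\<And>v. v \<in> P1_zero \<Omega> \<T> \<Longrightarrow> \<forall>z\<in>Z. apply_bcontfun v z = 0 \<Longrightarrow> v = 0"
    using finite_nodes[OF assms] by blast
  obtain b where b: "\<forall>z\<in>Z. b z \<in> P1_zero \<Omega> \<T>"
    "\<forall>v\<in>P1_zero \<Omega> \<T>. v = (\<Sum>z\<in>Z. apply_bcontfun v z *\<^sub>R b z)"
    using separating_functionals_reconstruct[OF Z(1) subspace_P1_zero[of \<Omega> \<T>],
        where \<phi> = "\<lambda>z v. apply_bcontfun v z"] Z(2)
    by (auto intro: lin_on_bounded_linear bounded_linear_apply_bcontfun)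
  show thesis
  proof (rule that[OF Z(1)])
    \<comment> \<open>The default 0 off \<open>Z\<close> makes membership hold for every
      \<open>z\<close>.\<close>
    show "(if z \<in> Z then b z else 0) \<in> P1_zero \<Omega> \<T>" for z
      using b(1) by (simp add: subspace_0[OF subspace_P1_zero])
    show "v = (\<Sum>z\<in>Z. apply_bcontfun v z *\<^sub>R (if z \<in> Z then b z else 0))" if "v \<in> P1_zero \<Omega> \<T>" for v
      using bspec[OF b(2) that] by (simp cong: sum.cong)
  qed
qed

text \<open>The nodal reconstruction is a continuous map with values in the space, and the space is
  its fixed-point set.\<close>

lemma closed_P1_zero:
  assumes "mesh_of \<Omega> \<T>"
  shows "closed (P1_zero \<Omega> \<T>)"
proof -
  obtain Z b where Zb: "finite Z" "\<And>z. b z \<in> P1_zero \<Omega> \<T>"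
    "\<And>v. v \<in> P1_zero \<Omega> \<T> \<Longrightarrow> v = (\<Sum>z\<in>Z. apply_bcontfun v z *\<^sub>R b z)"
    using P1_zero_reconstruct[OF assms] by blast
  have "(\<Sum>z\<in>Z. apply_bcontfun v z *\<^sub>R b z) \<in> P1_zero \<Omega> \<T>" for v
    by (intro subspace_sum subspace_scale subspace_P1_zero Zb)
  then have "P1_zero \<Omega> \<T> = {v. v = (\<Sum>z\<in>Z. apply_bcontfun v z *\<^sub>R b z)}"
    using Zb(3) by auto metis
  moreover have "continuous_on UNIV (\<lambda>v. \<Sum>z\<in>Z. apply_bcontfun v z *\<^sub>R b z)"
    by (intro continuous_intros linear_continuous_on bounded_linear_apply_bcontfun)
  then have "closed {v. v = (\<Sum>z\<in>Z. apply_bcontfun v z *\<^sub>R b z)}"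
    by (intro closed_Collect_eq continuous_on_id)
  ultimately show ?thesis by simp
qed

text \<open>Composing the functional with the nodal reconstruction makes it bounded linear on all
  bounded continuous functions. In this form it can be interchanged with derivatives.\<close>

lemma lin_on_P1_zero_extend:
  fixes \<l> :: "'a::euclidean_space fe \<Rightarrow> real"
  assumes "mesh_of \<Omega> \<T>" "lin_on (P1_zero \<Omega> \<T>) \<l>"
  obtains \<l>' where "bounded_linear \<l>'" "\<And>v. v \<in> P1_zero \<Omega> \<T> \<Longrightarrow> \<l>' v = \<l> v"
proof -
  obtain Z b where Zb: "finite Z" "\<And>z. b z \<in> P1_zero \<Omega> \<T>"
    "\<And>v. v \<in> P1_zero \<Omega> \<T> \<Longrightarrow> v = (\<Sum>z\<in>Z. apply_bcontfun v z *\<^sub>R b z)"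
    using P1_zero_reconstruct[OF assms(1)] by blast
  show thesis
  proof
    show "bounded_linear (\<lambda>v. \<Sum>z\<in>Z. apply_bcontfun v z *\<^sub>R \<l> (b z))"
      by (intro bounded_linear_sum bounded_linear_compose[OF bounded_linear_scaleR_left]
          bounded_linear_apply_bcontfun)
    show "(\<Sum>z\<in>Z. apply_bcontfun v z *\<^sub>R \<l> (b z)) = \<l> v" if "v \<in> P1_zero \<Omega> \<T>" for v
      using lin_on_sum[OF subspace_P1_zero assms(2) Zb(1), of b "apply_bcontfun v"] Zb(2)
      by (simp flip: Zb(3)[OF that])
  qed
qed

section \<open>Energy norm and dual norm\<close>

lemma inner_product_on_nonneg:
  assumes "subspace V" "inner_product_on V a" "v \<in> V"
  shows "0 \<le> a v v"
proof (cases "v = 0")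
  case True
  then show ?thesis
    using lin_on_zero[OF assms(1), of "a v"] assms(2,3) by (simp add: inner_product_on_def)
next
  case False
  then show ?thesis using assms(2,3) by (simp add: inner_product_on_def less_imp_le)
qed

text \<open>The square of \<open>v\<close> minus its orthogonal projection onto \<open>u\<close> is
  nonnegative. The case \<open>u = 0\<close> is separate because the projection coefficient
  \<open>t\<close> divides by \<open>a u u\<close>.\<close>

lemma inner_product_on_Cauchy_Schwarz:
  assumes V: "subspace V" and a: "inner_product_on V a" and uv: "u \<in> V" "v \<in> V"
  shows "\<bar>a u v\<bar> \<le> sqrt (a u u) * sqrt (a v v)"
proof (cases "u = 0")
  case True
  have "a 0 v = a v 0" using a uv True by (auto simp: inner_product_on_def)
  also have "\<dots> = 0" using lin_on_zero[OF V] a uv by (auto simp: inner_product_on_def)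
  finally show ?thesis using True inner_product_on_nonneg[OF V a] uv by simp
next
  case False
  have lin: "lin_on V (a w)" if "w \<in> V" for w using a that by (simp add: inner_product_on_def)
  have sym: "a w w' = a w' w" if "w \<in> V" "w' \<in> V" for w w'
    using a that by (simp add: inner_product_on_def)
  have pos: "a u u > 0" using a uv False by (simp add: inner_product_on_def)
  define t where "t = a u v / a u u"
  have tV: "t *\<^sub>R u \<in> V" using V uv by (simp add: subspace_scale)
  have wV: "v - t *\<^sub>R u \<in> V" using V uv tV by (simp add: subspace_diff)
  have exp: "a w (v - t *\<^sub>R u) = a w v - t * a w u" if "w \<in> V" for w
    using lin_on_diff[OF V lin[OF that] uv(2) tV] lin_on_scale[OF lin[OF that] uv(1)] by simp
  have "0 \<le> a (v - t *\<^sub>R u) (v - t *\<^sub>R u)" by (rule inner_product_on_nonneg[OF V a wV])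
  also have "\<dots> = a v (v - t *\<^sub>R u) - t * a u (v - t *\<^sub>R u)"
    using exp[OF wV] sym[OF wV] uv by simp
  also have "\<dots> = a v v - 2 * t * a u v + t\<^sup>2 * a u u"
    unfolding exp[OF uv(1)] exp[OF uv(2)] sym[OF uv(2,1)]
    by (simp add: algebra_simps power2_eq_square)
  also have "\<dots> = a v v - (a u v)\<^sup>2 / a u u"
    using pos by (simp add: t_def power2_eq_square field_simps)
  finally have "(a u v)\<^sup>2 \<le> a u u * a v v" using pos by (simp add: field_simps)
  then have "sqrt ((a u v)\<^sup>2) \<le> sqrt (a u u * a v v)" by (rule real_sqrt_le_mono)
  then show ?thesis by (simp add: real_sqrt_mult)
qed

text \<open>The functionals \<open>a (b k)\<close> of a spanning family separate points, so
  \<open>v\<close> can be rebuilt from the numbers \<open>a (b k) v\<close>, and Cauchy-Schwarz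
  bounds each of these.\<close>

lemma lin_on_energy_bounded:
  fixes a :: "'v::real_vector \<Rightarrow> 'v \<Rightarrow> real"
  assumes V: "subspace V" and a: "inner_product_on V a" and F: "lin_on V F"
    and K: "finite K" "\<And>k. k \<in> K \<Longrightarrow> b k \<in> V" "\<And>v. v \<in> V \<Longrightarrow> \<exists>c. v = (\<Sum>k\<in>K. c k *\<^sub>R b k)"
  obtains C :: real where "\<And>v. v \<in> V \<Longrightarrow> \<bar>F v\<bar> \<le> C * sqrt (a v v)"
proof -
  have lin: "lin_on V (a w)" if "w \<in> V" for w using a that by (simp add: inner_product_on_def)
  \<comment> \<open>Expanding the second argument of \<open>a v v\<close> in the \<open>b k\<close>
    leaves only terms that vanish by symmetry.\<close>
  have sep: "v = 0" if v: "v \<in> V" "\<forall>k\<in>K. a (b k) v = 0" for v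
  proof -
    obtain c where c: "v = (\<Sum>k\<in>K. c k *\<^sub>R b k)" using K(3) v by blast
    have "a v v = (\<Sum>k\<in>K. c k *\<^sub>R a v (b k))"
      using lin_on_sum[OF V lin[OF v(1)] K(1), of b c] K(2) by (simp flip: c)
    also have "\<dots> = 0" using a K(2) v by (intro sum.neutral) (simp add: inner_product_on_def)
    finally have "a v v = 0" .
    moreover have "v \<noteq> 0 \<Longrightarrow> a v v > 0" using a v(1) by (simp add: inner_product_on_def)
    ultimately show ?thesis by (cases "v = 0") auto
  qed
  obtain d where d: "\<forall>k\<in>K. d k \<in> V" "\<forall>v\<in>V. v = (\<Sum>k\<in>K. a (b k) v *\<^sub>R d k)"
    using separating_functionals_reconstruct[OF K(1) V, where \<phi> = "\<lambda>k. a (b k)"] lin K(2) sep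
    by blast
  show thesis
  proof (rule that)
    fix v assume v: "v \<in> V"
    have "F v = F (\<Sum>k\<in>K. a (b k) v *\<^sub>R d k)" using d(2) v by metis
    also have "\<dots> = (\<Sum>k\<in>K. a (b k) v *\<^sub>R F (d k))"
      using d(1) by (intro lin_on_sum[OF V F K(1)]) auto
    finally have "\<bar>F v\<bar> \<le> (\<Sum>k\<in>K. \<bar>a (b k) v\<bar> * \<bar>F (d k)\<bar>)"
      using sum_abs[of "\<lambda>k. a (b k) v * F (d k)" K] by (simp add: abs_mult)
    also have "\<dots> \<le> (\<Sum>k\<in>K. sqrt (a (b k) (b k)) * sqrt (a v v) * \<bar>F (d k)\<bar>)"
      using K(2) v by (intro sum_mono mult_right_mono inner_product_on_Cauchy_Schwarz[OF V a]) auto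
    finally show "\<bar>F v\<bar> \<le> (\<Sum>k\<in>K. sqrt (a (b k) (b k)) * \<bar>F (d k)\<bar>) * sqrt (a v v)"
      by (simp add: sum_distrib_left mult_ac)
  qed
qed

section \<open>The energy norm on the fine space\<close>

lemma subspace_V_h: "subspace (V_h S)"
  by (simp add: V_h_def subspace_P1_zero)

lemma subspace_V_H: "subspace (V_H S)"
  by (simp add: V_H_def subspace_P1_zero)

lemma V_H_subset_V_h: "discretization S \<Longrightarrow> V_H S \<subseteq> V_h S"
  by (simp add: discretization_def V_H_def V_h_def P1_zero_refines)

lemma normV_nonneg: "discretization S \<Longrightarrow> v \<in> V_h S \<Longrightarrow> 0 \<le> normV S v"
  using inner_product_on_nonneg[OF subspace_V_h, of S "energy S" v]
  by (simp add: discretization_def normV_def)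

lemma normV_zero_iff:
  assumes "discretization S" "v \<in> V_h S"
  shows "normV S v = 0 \<longleftrightarrow> v = 0"
proof -
  have ip: "inner_product_on (V_h S) (energy S)" using assms by (simp add: discretization_def)
  then have "energy S 0 0 = 0"
    using lin_on_zero[OF subspace_V_h, of S "energy S 0"] subspace_0[OF subspace_V_h, of S]
    by (simp add: inner_product_on_def)
  moreover have "energy S v v > 0" if "v \<noteq> 0"
    using ip assms(2) that by (simp add: inner_product_on_def)
  ultimately show ?thesis by (cases "v = 0") (auto simp: normV_def)
qed

lemma normV_scaleR:
  assumes "discretization S" "v \<in> V_h S"
  shows "normV S (c *\<^sub>R v) = \<bar>c\<bar> * normV S v"
proof -
  have ip: "inner_product_on (V_h S) (energy S)" using assms by (simp add: discretization_def)
  have cv: "c *\<^sub>R v \<in> V_h S" using assms subspace_V_h subspace_scale by blast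
  have "energy S (c *\<^sub>R v) (c *\<^sub>R v) = c * energy S (c *\<^sub>R v) v"
    using ip cv assms(2) lin_on_scale[of "V_h S" "energy S (c *\<^sub>R v)"]
    by (simp add: inner_product_on_def)
  also have "energy S (c *\<^sub>R v) v = energy S v (c *\<^sub>R v)"
    using ip cv assms(2) by (simp add: inner_product_on_def)
  also have "\<dots> = c * energy S v v"
    using ip assms(2) lin_on_scale[of "V_h S" "energy S v"] by (simp add: inner_product_on_def)
  finally show ?thesis by (simp add: normV_def real_sqrt_mult flip: mult.assoc)
qed

text \<open>A real \<open>Sup\<close> bounds its set only if the set is bounded above; finite
  dimension provides this through \<open>lin_on_energy_bounded\<close>.\<close>

lemma abs_le_dual_norm:
  assumes S: "discretization S" and F: "lin_on (V_h S) F" and v: "v \<in> V_h S"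
  shows "\<bar>F v\<bar> \<le> dual_norm S F * normV S v"
proof (cases "v = 0")
  case True
  then show ?thesis using lin_on_zero[OF subspace_V_h F] normV_zero_iff[OF S v] by simp
next
  case False
  have ip: "inner_product_on (V_h S) (energy S)" and mesh: "mesh_of (domain S) (fmesh S)"
    using S by (simp_all add: discretization_def)
  have pos: "0 < normV S w" if "w \<in> V_h S" "w \<noteq> 0" for w
    using normV_nonneg[OF S] normV_zero_iff[OF S] that by (simp add: order_less_le)
  obtain Z b where Zb: "finite Z" "\<And>z. b z \<in> V_h S"
    "\<And>v. v \<in> V_h S \<Longrightarrow> v = (\<Sum>z\<in>Z. apply_bcontfun v z *\<^sub>R b z)"
    using P1_zero_reconstruct[OF mesh] unfolding V_h_def by blast
  obtain C where C: "\<And>v. v \<in> V_h S \<Longrightarrow> \<bar>F v\<bar> \<le> C * normV S v"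
    unfolding normV_def
    using lin_on_energy_bounded[OF subspace_V_h ip F Zb(1), of b] Zb(2,3) by blast
  have "bdd_above (insert 0 {\<bar>F v\<bar> / normV S v | v. v \<in> V_h S \<and> v \<noteq> 0})"
    unfolding bdd_above_insert
    by (rule bdd_aboveI[where M = C]) (use C pos in \<open>auto simp: divide_le_eq\<close>)
  then have "\<bar>F v\<bar> / normV S v \<le> dual_norm S F"
    unfolding dual_norm_def using v False by (intro cSup_upper) auto
  then show ?thesis using pos[OF v False] by (simp add: divide_le_eq)
qed

section \<open>The reconstruction maps\<close>

text \<open>A basis function whose coefficient is not recorded in \<open>P_loc\<close> has support
  disjoint from the patch, so it contributes nothing there.\<close>

lemma eq_on_patch:
  assumes cb: "coarse_basis S" and v: "v \<in> V_H S" "v' \<in> V_H S"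
    and P: "P_loc S i v = P_loc S i v'" and x: "x \<in> \<omega>l S i"
  shows "apply_bcontfun v x = apply_bcontfun v' x"
proof -
  have expand: "apply_bcontfun u x = (\<Sum>j<cdim S. coarse_coeff S u j * apply_bcontfun (cbasis S j) x)"
    if "u \<in> V_H S" for u
  proof -
    have "u = (\<Sum>b\<in>cbasis S ` {..<cdim S}. representation (cbasis S ` {..<cdim S}) u b *\<^sub>R b)"
      using cb that by (intro sum_representation_eq[symmetric]) (auto simp: coarse_basis_def)
    also have "\<dots> = (\<Sum>j<cdim S. coarse_coeff S u j *\<^sub>R cbasis S j)"
      using cb by (subst sum.reindex) (auto simp: coarse_basis_def coarse_coeff_def)
    finally have "apply_bcontfun u x = apply_bcontfun (\<Sum>j<cdim S. coarse_coeff S u j *\<^sub>R cbasis S j) x"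
      by (rule arg_cong)
    then show ?thesis by (simp add: apply_bcontfun_sum)
  qed
  have "coarse_coeff S v j * apply_bcontfun (cbasis S j) x =
      coarse_coeff S v' j * apply_bcontfun (cbasis S j) x" if j: "j < cdim S" for j
  proof (cases "j \<in> set (P_inds S i)")
    case True
    then show ?thesis using P by (simp add: P_loc_def)
  next
    case False
    then have "x \<notin> fsupp (apply_bcontfun (cbasis S j))" using j x by (auto simp: P_inds_def)
    moreover have "{x. apply_bcontfun (cbasis S j) x \<noteq> 0} \<subseteq> fsupp (apply_bcontfun (cbasis S j))"
      unfolding fsupp_def by (rule closure_subset)
    ultimately have "apply_bcontfun (cbasis S j) x = 0" by auto
    then show ?thesis by simp
  qed
  then show ?thesis unfolding expand[OF v(1)] expand[OF v(2)] by (intro sum.cong) auto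
qed

text \<open>The description in \<open>local_correction\<close> quantifies over all coarse functions
  with the given coefficients. These agree on the patch and the patch form sees nothing else, so
  unique solvability for one of them suffices.\<close>

lemma local_correction_in_V_h:
  assumes S: "multiscale_setting S" and i: "i \<in> indices S" and v: "v \<in> V_H S"
  shows "local_correction S i (P_loc S i v) \<in> V_h S"
proof -
  have sub: "V_H S \<subseteq> V_h S" using S by (simp add: multiscale_setting_def V_H_subset_V_h)
  have cb: "coarse_basis S" and ex1: "\<exists>!c. local_correction_eq S i v c"
    and restr: "restricts_to_patch S i"
    using S i v by (auto simp: multiscale_setting_def local_corrections_def)
  have transfer: "local_correction_eq S i v' c"
    if c: "local_correction_eq S i v c" and v': "v' \<in> V_H S" and P: "P_loc S i v' = P_loc S i v" for c v'
  proof -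
    have cV: "c \<in> V_h S" using c by (simp add: local_correction_eq_def V_fi_def V_f_def)
    have "patch_form S i (v' + c) w = patch_form S i (v + c) w" if "w \<in> V_fi S i" for w
    proof -
      have "w \<in> V_h S" using that by (simp add: V_fi_def V_f_def)
      moreover have "v' + c \<in> V_h S" "v + c \<in> V_h S"
        using v v' sub cV by (auto intro!: subspace_add subspace_V_h)
      moreover have "\<forall>x\<in>\<omega>l S i. apply_bcontfun (v' + c) x = apply_bcontfun (v + c) x"
        using eq_on_patch[OF cb v' v P] by simp
      ultimately show ?thesis using restr unfolding restricts_to_patch_def by blast
    qed
    then show ?thesis using c by (simp add: local_correction_eq_def)
  qed
  have "local_correction_eq S i v (local_correction S i (P_loc S i v))"
  proof -
    have "\<exists>!c. \<forall>v'\<in>V_H S. P_loc S i v' = P_loc S i v \<longrightarrow> local_correction_eq S i v' c"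
      using ex1 transfer v by metis
    from theI'[OF this] show ?thesis using v by (simp add: local_correction_def)
  qed
  then show ?thesis by (simp add: local_correction_eq_def V_fi_def V_f_def)
qed

lemma local_function_in_fine_functions:
  assumes S: "multiscale_setting S" and i: "i \<in> indices S" and v: "v \<in> V_H S"
  shows "local_function S i (P_loc S i v) \<in> fine_functions S i"
proof (cases "mode S")
  case Patch_Solved
  then show ?thesis
    using local_correction_in_V_h[OF assms] by (auto simp: local_function_def fine_functions_def)
next
  case Network_Interpolated
  have "bij_betw (fine_of_coeffs S i) {c. length c = fdim S i} (fine_functions S i)"
    and "length (net S i (net_param S i) (P_loc S i v)) = fdim S i"
    using S i by (auto simp: multiscale_setting_def network_maps_def P_loc_def)
  then show ?thesis
    using Network_Interpolated bij_betwE by (fastforce simp: local_function_def)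
qed

text \<open>The term added to \<open>v\<close> has the form \<open>c - proj S c\<close>, which the
  idempotent projection annihilates in either reconstruction mode.\<close>

lemma M_tilde_V_H:
  assumes S: "multiscale_setting S" and v: "v \<in> V_H S"
  shows "M_tilde S v \<in> V_h S" "proj S (M_tilde S v) = v"
proof -
  define f where "f = (\<lambda>x. \<Sum>i\<in>indices S. pou S i x * ext_zero (\<omega>0 S i) (local_function S i (P_loc S i v)) x)"
  define c where "c = interp S f"
  have "f \<in> interp_domain S"
    unfolding interp_domain_def f_def mem_Collect_eq
    \<comment> \<open>The second witness 0 is the global summand \<open>w\<close> allowed in
      \<open>interp_domain\<close>.\<close>
    by (rule exI[of _ "\<lambda>i. local_function S i (P_loc S i v)"], rule exI[of _ 0])
      (use local_function_in_fine_functions[OF S _ v] subspace_0[OF subspace_V_h] in auto)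
  then have c: "c \<in> V_h S"
    using S by (simp add: c_def multiscale_setting_def fine_interpolation_def)
  have sub: "V_H S \<subseteq> V_h S" using S by (simp add: multiscale_setting_def V_H_subset_V_h)
  have \<Pi>: "lin_on (V_h S) (proj S)" "proj S c \<in> V_H S" "proj S v = v" "proj S (proj S c) = proj S c"
    using S c v by (auto simp: multiscale_setting_def coarse_projection_def)
  have M: "M_tilde S v = v + (c - proj S c)" unfolding M_tilde_def c_def f_def Let_def ..
  have d: "c - proj S c \<in> V_h S" using c sub \<Pi> by (auto intro: subspace_diff subspace_V_h)
  then show "M_tilde S v \<in> V_h S" unfolding M using v sub by (auto intro: subspace_add subspace_V_h)
  have "proj S (c - proj S c) = 0"
    using lin_on_diff[OF subspace_V_h \<Pi>(1) c, of "proj S c"] \<Pi> sub by auto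
  then show "proj S (M_tilde S v) = v"
    unfolding M using lin_on_add[OF \<Pi>(1) _ d, of v] v sub \<Pi>(3) by auto
qed

text \<open>The difference \<open>u - proj S u\<close> lies in the kernel of the projection and
  solves the correction equation, since fine-scale test functions are admissible for
  \<open>u\<close>; uniqueness identifies it.\<close>

lemma M_h_proj_fine_solution:
  assumes S: "multiscale_setting S" and u: "fine_solution S u"
  shows "M_h S (proj S u) = u"
proof -
  have sub: "V_H S \<subseteq> V_h S" using S by (simp add: multiscale_setting_def V_H_subset_V_h)
  have uV: "u \<in> V_h S" using u by (simp add: fine_solution_def)
  have \<Pi>: "lin_on (V_h S) (proj S)" "proj S u \<in> V_H S" "proj S (proj S u) = proj S u"
    using S uV by (auto simp: multiscale_setting_def coarse_projection_def)
  have "proj S u \<in> V_h S" using \<Pi>(2) sub by blast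
  then have "u - proj S u \<in> V_f S"
    using lin_on_diff[OF subspace_V_h \<Pi>(1) uV] \<Pi>(3) uV
    by (simp add: V_f_def subspace_diff[OF subspace_V_h])
  then have eq: "fine_correction_eq S (proj S u) (u - proj S u)"
    using u by (simp add: fine_correction_eq_def fine_solution_def V_f_def)
  have "\<exists>!v. fine_correction_eq S (proj S u) v"
    using S \<Pi>(2) by (simp add: multiscale_setting_def ideal_corrections_def)
  then have "fine_correction S (proj S u) = u - proj S u"
    unfolding fine_correction_def using eq by (rule the1_equality)
  then show ?thesis by (simp add: M_h_def)
qed

section \<open>Derivatives along segments\<close>

lemma has_vector_derivative_along_line:
  assumes D: "(f has_derivative D) (at (x + s *\<^sub>R y) within W)" and W: "\<And>t. t \<in> T \<Longrightarrow> x + t *\<^sub>R y \<in> W"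
  shows "((\<lambda>t. f (x + t *\<^sub>R y)) has_vector_derivative D y) (at s within T)"
proof -
  have "((\<lambda>t. x + t *\<^sub>R y) has_derivative (\<lambda>h. h *\<^sub>R y)) (at s within T)"
    by (auto intro!: derivative_eq_intros)
  moreover have "(f has_derivative D) (at (x + s *\<^sub>R y) within (\<lambda>t. x + t *\<^sub>R y) ` T)"
    by (rule has_derivative_subset[OF D]) (use W in auto)
  ultimately have "((\<lambda>t. f (x + t *\<^sub>R y)) has_derivative (\<lambda>h. D (h *\<^sub>R y))) (at s within T)"
    by (rule has_derivative_in_compose)
  moreover have "D (h *\<^sub>R y) = h *\<^sub>R D y" for h
    using has_derivative_bounded_linear[OF D] by (simp add: bounded_linear.linear linear_cmul)
  ultimately show ?thesis by (simp add: has_vector_derivative_def)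
qed

text \<open>The derivative is a limit of difference quotients, which stay in \<open>V\<close>. The
  limit from the right is taken so that \<open>norm (t - s)\<close> is \<open>t - s\<close>.\<close>

lemma has_vector_derivative_in_closed_subspace:
  assumes V: "closed V" "subspace V" and g: "(g has_vector_derivative d) (at (s::real))" "\<And>t. g t \<in> V"
  shows "d \<in> V"
proof -
  have "((\<lambda>t. (1 / norm (t - s)) *\<^sub>R (g t - (g s + (t - s) *\<^sub>R d))) \<longlongrightarrow> 0) (at_right s)"
    using has_vector_derivative_at_within[OF g(1), of "{s<..}"]
    by (simp add: has_vector_derivative_def has_derivative_within)
  moreover have "\<forall>\<^sub>F t in at_right s.
      (1 / norm (t - s)) *\<^sub>R (g t - (g s + (t - s) *\<^sub>R d)) = (g t - g s) /\<^sub>R (t - s) - d"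
    unfolding eventually_at_filter
    by (auto intro!: always_eventually simp: scaleR_diff_right scaleR_add_right divide_inverse)
  ultimately have "((\<lambda>t. (g t - g s) /\<^sub>R (t - s) - d) \<longlongrightarrow> 0) (at_right s)"
    by (rule Lim_transform_eventually)
  then have lim: "((\<lambda>t. (g t - g s) /\<^sub>R (t - s)) \<longlongrightarrow> d) (at_right s)"
    by (rule LIM_zero_cancel)
  have "(g t - g s) /\<^sub>R (t - s) \<in> V" for t
    by (intro subspace_scale subspace_diff V(2) g(2))
  then show ?thesis
    by (intro Lim_in_closed_set[OF V(1) _ _ lim]) auto
qed

text \<open>The whole line through \<open>v\<close> in direction \<open>\<xi>\<close> stays in
  \<open>V_H S\<close>, so the value is the derivative of a curve in the closed subspace
  \<open>V_h S\<close>.\<close>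

lemma DM_tilde_in_V_h:
  assumes S: "multiscale_setting S" and v: "v \<in> V_H S" "\<xi> \<in> V_H S" and diff: "M_differentiable_at S v"
  shows "DM_tilde S v \<xi> \<in> V_h S"
proof -
  have line: "v + t *\<^sub>R \<xi> \<in> V_H S" for t
    using v by (intro subspace_add subspace_scale subspace_V_H)
  have "(M_tilde S has_derivative DM_tilde S v) (at (v + 0 *\<^sub>R \<xi>) within V_H S)"
    using diff by (simp add: M_differentiable_at_def DM_tilde_def frechet_derivative_works)
  from has_vector_derivative_along_line[OF this, of UNIV] line
  have "((\<lambda>t. M_tilde S (v + t *\<^sub>R \<xi>)) has_vector_derivative DM_tilde S v \<xi>) (at 0)" by simp
  moreover have "closed (V_h S)"
    using S by (simp add: multiscale_setting_def discretization_def V_h_def closed_P1_zero)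
  ultimately show ?thesis
    using has_vector_derivative_in_closed_subspace[OF _ subspace_V_h] M_tilde_V_H(1)[OF S line] by blast
qed

text \<open>After subtraction of \<open>g' 0 * s\<close> and \<open>c / 2 * s\<^sup>2\<close> the
  derivative is at most 0, and the mean value theorem applies. The factor 1/2 in
  \<open>\<gamma>_ch\<close> originates here.\<close>

lemma remainder_le_quadratic:
  fixes g :: "real \<Rightarrow> real"
  assumes g: "\<And>s. 0 \<le> s \<Longrightarrow> s \<le> 1 \<Longrightarrow> (g has_vector_derivative g' s) (at s within {0..1})"
    and g': "\<And>s. 0 \<le> s \<Longrightarrow> s \<le> 1 \<Longrightarrow> g' s - g' 0 \<le> c * s"
  shows "g 1 - g 0 - g' 0 \<le> c / 2"
proof -
  define h where "h = (\<lambda>s. g s - g' 0 * s - c / 2 * s\<^sup>2)"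
  have "(h has_derivative (\<lambda>t. t * (g' s - g' 0 - c * s))) (at s within {0..1})"
    if "0 \<le> s" "s \<le> 1" for s
    unfolding h_def using g[OF that] unfolding has_vector_derivative_def
    by (auto intro!: derivative_eq_intros simp: algebra_simps)
  then obtain s where s: "s \<in> {0<..<1}" "h 1 - h 0 = (1 - 0) * (g' s - g' 0 - c * s)"
    using mvt_simple[of 0 1 h "\<lambda>s t. t * (g' s - g' 0 - c * s)"] by auto
  then show ?thesis using g'[of s] by (simp add: h_def)
qed

lemma functional_Taylor_M_tilde:
  assumes S: "multiscale_setting S" and U: "U_H \<subseteq> V_H S"
    and diff: "\<And>v. v \<in> U_H \<Longrightarrow> M_differentiable_at S v"
    and x: "x \<in> V_H S" "y \<in> V_H S" and seg: "\<And>s. 0 \<le> s \<Longrightarrow> s \<le> 1 \<Longrightarrow> x + s *\<^sub>R y \<in> U_H"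
    and Lip: "\<And>v w \<xi>. v \<in> U_H \<Longrightarrow> w \<in> U_H \<Longrightarrow> \<xi> \<in> V_H S \<Longrightarrow>
        normV S (DM_tilde S v \<xi> - DM_tilde S w \<xi>) \<le> L * normV S (v - w) * normV S \<xi>"
    and F: "lin_on (V_h S) F" "\<And>v. v \<in> V_h S \<Longrightarrow> F v \<le> K * normV S v" "K \<ge> 0"
  shows "F (M_tilde S (x + y) - M_tilde S x - DM_tilde S x y) \<le> K * L * (normV S y)\<^sup>2 / 2"
proof -
  have disc: "discretization S" using S by (simp add: multiscale_setting_def)
  note V = subspace_V_h[of S]
  have yV: "y \<in> V_h S" using x V_H_subset_V_h[OF disc] by blast
  \<comment> \<open>\<open>F\<close> is linear on \<open>V_h S\<close> only; its bounded linear
    extension \<open>G\<close> can be composed with the differentiable curve.\<close>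
  obtain G where G: "bounded_linear G" "\<And>v. v \<in> V_h S \<Longrightarrow> G v = F v"
    using lin_on_P1_zero_extend[of "domain S" "fmesh S" F] disc F(1)
    by (auto simp: discretization_def V_h_def)
  have line: "x + s *\<^sub>R y \<in> V_H S" for s
    using x by (intro subspace_add subspace_scale subspace_V_H)
  have DV: "DM_tilde S (x + s *\<^sub>R y) y \<in> V_h S" if "0 \<le> s" "s \<le> 1" for s
    using DM_tilde_in_V_h[OF S line x(2)] diff[OF seg] that by blast
  have deriv: "((\<lambda>s. G (M_tilde S (x + s *\<^sub>R y))) has_vector_derivative
      G (DM_tilde S (x + s *\<^sub>R y) y)) (at s within {0..1})" if "0 \<le> s" "s \<le> 1" for s
  proof -
    have "(M_tilde S has_derivative DM_tilde S (x + s *\<^sub>R y)) (at (x + s *\<^sub>R y) within V_H S)"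
      using diff[OF seg] that by (simp add: M_differentiable_at_def DM_tilde_def frechet_derivative_works)
    from bounded_linear.has_vector_derivative[OF G(1) has_vector_derivative_along_line[OF this line]]
    show ?thesis .
  qed
  \<comment> \<open>The distance from the starting point is \<open>s * normV S y\<close>, which
    gives the growth linear in \<open>s\<close> required by
    \<open>remainder_le_quadratic\<close>.\<close>
  have "G (DM_tilde S (x + s *\<^sub>R y) y) - G (DM_tilde S (x + 0 *\<^sub>R y) y) \<le> (K * L * (normV S y)\<^sup>2) * s"
    if s: "0 \<le> s" "s \<le> 1" for s
  proof -
    have "G (DM_tilde S (x + s *\<^sub>R y) y) - G (DM_tilde S (x + 0 *\<^sub>R y) y)
        = F (DM_tilde S (x + s *\<^sub>R y) y - DM_tilde S (x + 0 *\<^sub>R y) y)"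
      using DV[OF s] DV[of 0] G(2) lin_on_diff[OF V F(1)] by simp
    also have "\<dots> \<le> K * normV S (DM_tilde S (x + s *\<^sub>R y) y - DM_tilde S (x + 0 *\<^sub>R y) y)"
      using DV[OF s] DV[of 0] V by (intro F(2) subspace_diff) auto
    also have "\<dots> \<le> K * (L * normV S (x + s *\<^sub>R y - (x + 0 *\<^sub>R y)) * normV S y)"
      using seg[OF s] seg[of 0] x(2) by (intro mult_left_mono Lip F(3)) auto
    also have "normV S (x + s *\<^sub>R y - (x + 0 *\<^sub>R y)) = s * normV S y"
      using normV_scaleR[OF disc yV, of s] s by simp
    finally show ?thesis by (simp add: power2_eq_square mult_ac)
  qed
  from remainder_le_quadratic[OF deriv this]
  have "G (M_tilde S (x + y)) - G (M_tilde S x) - G (DM_tilde S x y) \<le> K * L * (normV S y)\<^sup>2 / 2"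
    by simp
  moreover have "M_tilde S x \<in> V_h S" "M_tilde S (x + y) \<in> V_h S" "DM_tilde S x y \<in> V_h S"
    using M_tilde_V_H(1)[OF S line, of 0] M_tilde_V_H(1)[OF S line, of 1] DV[of 0] by simp_all
  ultimately show ?thesis
    using G(2) V by (simp add: lin_on_diff[OF V F(1)] subspace_diff)
qed

section \<open>Error estimate by absorption of the quadratic remainder\<close>

theorem proposition7p1:
  fixes S :: "('a::euclidean_space, 'i) multiscale"
    and u_h ut_H ut_ms e_h e_loc :: "'a fe"
    and U_h U_H :: "'a fe set"
    and m_A L_A L_M1 \<gamma>_ch :: real
  assumes setting: "multiscale_setting S"
    and u_h: "fine_solution S u_h" "\<And>u. fine_solution S u \<Longrightarrow> u = u_h"
    and admissible: "U_h \<subseteq> V_h S" "U_H \<subseteq> V_H S"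
    and differentiable: "\<And>vH. vH \<in> U_H \<Longrightarrow> M_differentiable_at S vH"
    and coarse_state: "ut_H \<in> V_H S"
    and segment: "\<And>s. 0 \<le> s \<Longrightarrow> s \<le> 1 \<Longrightarrow> ut_H + s *\<^sub>R (proj S u_h - ut_H) \<in> U_H"
    and ut_ms: "ut_ms = M_tilde S ut_H"
    and in_U_h: "u_h \<in> U_h" "ut_ms \<in> U_h" "M_tilde S (proj S u_h) \<in> U_h"
    and pos: "m_A > 0" "L_A > 0"
    and monotone: "\<And>v w. v \<in> U_h \<Longrightarrow> w \<in> U_h \<Longrightarrow>
        m_A * (normV S (v - w))\<^sup>2 \<le> form S v (v - w) - form S w (v - w)"
    and Lipschitz: "\<And>v w. v \<in> U_h \<Longrightarrow> w \<in> U_h \<Longrightarrow>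
        dual_norm S (\<lambda>z. form S v z - form S w z) \<le> L_A * normV S (v - w)"
    and DM_Lipschitz: "\<And>vH wH \<xi>. vH \<in> U_H \<Longrightarrow> wH \<in> U_H \<Longrightarrow> \<xi> \<in> V_H S \<Longrightarrow>
        normV S (DM_tilde S vH \<xi> - DM_tilde S wH \<xi>) \<le> L_M1 * normV S (vH - wH) * normV S \<xi>"
    and coarse_problem: "\<And>\<xi>. \<xi> \<in> V_H S \<Longrightarrow> Res S ut_ms (DM_tilde S ut_H \<xi>) = 0"
    and e_h: "e_h = u_h - ut_ms"
    and \<gamma>_ch: "\<gamma>_ch = 1 / 2 * L_A * L_M1 * (proj_const S)\<^sup>2"
    and e_loc: "e_loc = M_h S (proj S u_h) - M_tilde S (proj S u_h)"
    and small: "\<gamma>_ch * normV S e_h \<le> 1 / 2 * m_A"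
  shows "normV S (u_h - ut_ms) \<le> 2 * L_A / m_A * normV S e_loc"
proof -
  have disc: "discretization S" and var: "variational_problem S" and cp: "coarse_projection S"
    using setting by (simp_all add: multiscale_setting_def)
  note V = subspace_V_h[of S] and V_H = subspace_V_H[of S]
  have V_H_V_h: "V_H S \<subseteq> V_h S" by (rule V_H_subset_V_h[OF disc])
  have uV: "u_h \<in> V_h S" and msV: "ut_ms \<in> V_h S" using in_U_h admissible by auto
  have eV: "e_h \<in> V_h S" unfolding e_h by (rule subspace_diff[OF V uV msV])
  have \<Pi>lin: "lin_on (V_h S) (proj S)" and \<Pi>u: "proj S u_h \<in> V_H S"
    using cp uV by (auto simp: coarse_projection_def)
  define \<delta> where "\<delta> = proj S u_h - ut_H"
  have \<delta>_V_H: "\<delta> \<in> V_H S" unfolding \<delta>_def by (rule subspace_diff[OF V_H \<Pi>u coarse_state])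
  then have \<delta>V: "\<delta> \<in> V_h S" using V_H_V_h by blast
  \<comment> \<open>The right-inverse property gives \<open>proj S ut_ms = ut_H\<close>.\<close>
  have "\<delta> = proj S e_h"
    using lin_on_diff[OF V \<Pi>lin uV msV] M_tilde_V_H(2)[OF setting coarse_state]
    by (simp add: \<delta>_def e_h ut_ms)
  then have \<delta>_le: "normV S \<delta> \<le> proj_const S * normV S e_h"
    using cp eV by (simp add: coarse_projection_def)
  define F where "F = (\<lambda>w. form S u_h w - form S ut_ms w)"
  have F_Res: "F w = Res S ut_ms w" if "w \<in> V_h S" for w
    using u_h(1) that by (simp add: F_def Res_def fine_solution_def)
  have F_lin: "lin_on (V_h S) F"
    using var uV msV by (auto simp: F_def variational_problem_def lin_on_def algebra_simps)
  have e_pos: "0 \<le> normV S e_h" by (rule normV_nonneg[OF disc eV])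
  \<comment> \<open>The Lipschitz bound for the form makes \<open>K\<close> an upper bound of the
    dual norm of \<open>F\<close>.\<close>
  define K where "K = L_A * normV S e_h"
  have K: "0 \<le> K" using pos e_pos by (simp add: K_def)
  have F_le: "F w \<le> K * normV S w" if "w \<in> V_h S" for w
  proof -
    have "F w \<le> dual_norm S F * normV S w" using abs_le_dual_norm[OF disc F_lin that] by simp
    also have "\<dots> \<le> K * normV S w"
      using Lipschitz[OF in_U_h(1,2)] normV_nonneg[OF disc that]
      by (intro mult_right_mono) (auto simp: F_def K_def e_h)
    finally show ?thesis .
  qed
  define r where "r = M_tilde S (ut_H + \<delta>) - M_tilde S ut_H - DM_tilde S ut_H \<delta>"
  have F_r: "F r \<le> K * L_M1 * (normV S \<delta>)\<^sup>2 / 2"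
    unfolding r_def
    by (rule functional_Taylor_M_tilde[OF setting admissible(2) differentiable coarse_state \<delta>_V_H
          segment[folded \<delta>_def] DM_Lipschitz F_lin F_le K])
  have ut_H: "ut_H \<in> U_H" and \<Pi>u_U: "proj S u_h \<in> U_H" using segment[of 0] segment[of 1] by auto
  \<comment> \<open>The sign of \<open>L_M1\<close> is not prescribed. The derivative bound between
    the two ends of the segment still yields a nonnegative product.\<close>
  have L_nonneg: "0 \<le> L_M1 * (normV S \<delta>)\<^sup>2"
  proof -
    have D: "DM_tilde S v \<delta> \<in> V_h S" if "v \<in> U_H" for v
      using DM_tilde_in_V_h[OF setting _ \<delta>_V_H differentiable[OF that]] that admissible(2) by auto
    have "0 \<le> normV S (DM_tilde S (proj S u_h) \<delta> - DM_tilde S ut_H \<delta>)"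
      using D[OF ut_H] D[OF \<Pi>u_U] by (intro normV_nonneg[OF disc] subspace_diff V)
    also have "\<dots> \<le> L_M1 * normV S \<delta> * normV S \<delta>"
      using DM_Lipschitz[OF \<Pi>u_U ut_H \<delta>_V_H] by (simp add: \<delta>_def)
    finally show ?thesis by (simp add: power2_eq_square mult_ac)
  qed
  \<comment> \<open>As \<open>ut_H + \<delta>\<close> is \<open>proj S u_h\<close> and
    \<open>M_h\<close> maps that to \<open>u_h\<close>, the sum telescopes.\<close>
  have split: "e_h = (e_loc + r) + DM_tilde S ut_H \<delta>"
    using M_h_proj_fine_solution[OF setting u_h(1)]
    by (simp add: e_h e_loc r_def \<delta>_def ut_ms)
  have DV: "DM_tilde S ut_H \<delta> \<in> V_h S"
    by (rule DM_tilde_in_V_h[OF setting coarse_state \<delta>_V_H differentiable[OF ut_H]])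
  have locV: "e_loc \<in> V_h S"
    using M_h_proj_fine_solution[OF setting u_h(1)] M_tilde_V_H(1)[OF setting \<Pi>u] uV
    by (simp add: e_loc subspace_diff[OF V])
  have rV: "r \<in> V_h S"
    using M_tilde_V_H(1)[OF setting \<Pi>u] M_tilde_V_H(1)[OF setting coarse_state] DV
    by (simp add: r_def \<delta>_def subspace_diff[OF V])
  have "F e_h = F e_loc + F r + F (DM_tilde S ut_H \<delta>)"
    unfolding split[THEN arg_cong[of _ _ F]]
    using locV rV DV by (simp add: lin_on_add[OF F_lin] subspace_add[OF V])
  also have "F (DM_tilde S ut_H \<delta>) = 0"
    using coarse_problem[OF \<delta>_V_H] by (simp add: F_Res[OF DV])
  finally have F_e: "F e_h \<le> K * normV S e_loc + K * L_M1 * (normV S \<delta>)\<^sup>2 / 2"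
    using F_r F_le[OF locV] by simp
  have coercive: "m_A * (normV S e_h)\<^sup>2 \<le> F e_h"
    using monotone[OF in_U_h(1,2)] by (simp add: F_def e_h)
  \<comment> \<open>This is the remainder bound with one factor \<open>normV S e_h\<close> removed;
    smallness limits it to half of the coercivity term.\<close>
  have quad: "L_A * L_M1 * (normV S \<delta>)\<^sup>2 / 2 \<le> m_A / 2 * normV S e_h"
  proof (cases "0 \<le> L_M1")
    case True
    have "(normV S \<delta>)\<^sup>2 \<le> (proj_const S * normV S e_h)\<^sup>2"
      by (rule power_mono[OF \<delta>_le normV_nonneg[OF disc \<delta>V]])
    then have "L_A * L_M1 * (normV S \<delta>)\<^sup>2 \<le> L_A * L_M1 * (proj_const S * normV S e_h)\<^sup>2"
      using True pos by (intro mult_left_mono) auto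
    then have "L_A * L_M1 * (normV S \<delta>)\<^sup>2 / 2 \<le> (\<gamma>_ch * normV S e_h) * normV S e_h"
      by (simp add: \<gamma>_ch power2_eq_square mult_ac)
    also have "\<dots> \<le> 1 / 2 * m_A * normV S e_h" by (rule mult_right_mono[OF small e_pos])
    finally show ?thesis by simp
  next
    case False
    \<comment> \<open>For negative \<open>L_M1\<close>, \<open>L_nonneg\<close> forces the product
      to be 0.\<close>
    then have "L_M1 * (normV S \<delta>)\<^sup>2 \<le> 0" by (simp add: mult_le_0_iff)
    with L_nonneg have "L_M1 * (normV S \<delta>)\<^sup>2 = 0" by simp
    then have "L_A * L_M1 * (normV S \<delta>)\<^sup>2 / 2 = 0" by auto
    then show ?thesis using pos e_pos by (simp only:) simp
  qed
  show ?thesis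
  proof (cases "normV S e_h = 0")
    case True
    then show ?thesis using pos normV_nonneg[OF disc locV] by (simp flip: e_h)
  next
    case False
    then have e: "0 < normV S e_h" using e_pos by simp
    \<comment> \<open>Every term carries a factor \<open>normV S e_h\<close>, which is positive here
      and cancels.\<close>
    have "normV S e_h * (m_A * normV S e_h) \<le>
        normV S e_h * (L_A * normV S e_loc + L_A * L_M1 * (normV S \<delta>)\<^sup>2 / 2)"
      using coercive F_e by (simp add: K_def power2_eq_square algebra_simps)
    then have "m_A * normV S e_h \<le> L_A * normV S e_loc + L_A * L_M1 * (normV S \<delta>)\<^sup>2 / 2"
      using e by simp
    \<comment> \<open>Moving half of the left side across produces the factor 2 of the
      estimate.\<close>
    with quad have "m_A * normV S e_h \<le> 2 * L_A * normV S e_loc" by linarith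
    then show ?thesis using pos by (simp add: field_simps flip: e_h)
  qed
qed

end
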